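(* Let $(G,\cdot)$ be a Smarandache loop with S-subgroup $H$, and let $(G,\circ)$ be a Smarandache $f,g$-principal isotope of $(G,\cdot)$, with $f,g\in H$. Then $SBS(G,\cdot)=SBS(G,\circ)$, where $SBS(G,\cdot)$ is formed relative to $(H,\cdot)$ and $SBS(G,\circ)$ relative to the S-subgroup $(H,\circ)$ of $(G,\circ)$.
   Context: A loop is a quasigroup with two-sided identity $e$. A Smarandache loop (S-loop) is a loop $(G,\cdot)$ having a subset $H$ such that $(H,\cdot)$ is a non-trivial subgroup (a subloop that is a group, $\{e\}\ne H\ne G$); $H$ is called an S-subgroup. Maps are written on the right and composed left to right. $SYM(G)$ is the group of all bijections of $G$; $yL_x=x\cdot y$, $yR_x=y\cdot x$. $AUT(G,\cdot)$ is the group of autotopisms, i.e. triples $(U,V,W)\in SYM(G)^3$ with $xU\cdot yV=(x\cdot y)W$ for all $x,y\in G$. For an S-subgroup $H$: $SSYM(G,\cdot)$ consists of all $\theta\in SYM(G)$ with $h\theta\in H$ for all $h\in H$, and $SBS(G,\cdot)=\{\theta\in SSYM(G,\cdot): \exists f,g\in H,\ (\theta R_g^{-1},\theta L_f^{-1},\theta)\in AUT(G,\cdot)\}$. For $f,g\in H$, the Smarandache $f,g$-principal isotope $(G,\circ)$ of $(G,\cdot)$ is given by $x\circ y=xR_g^{-1}\cdot yL_f^{-1}$ for all $x,y\in G$; it is an S-loop with S-subgroup $(H,\circ)$. Writing $y\mathcal{L}_x=x\circ y$ and $y\mathcal{R}_x=y\circ x$ for the translations of $(G,\circ)$, and $AUT(G,\circ)$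 for the group of triples $(U,V,W)\in SYM(G)^3$ with $xU\circ yV=(x\circ y)W$ for all $x,y\in G$, $SBS(G,\circ)$ is the set of all $\theta\in SYM(G)$ such that $h\theta\in H$ for all $h\in H$ and there exist $f',g'\in H$ with $(\theta \mathcal{R}_{g'}^{-1},\theta \mathcal{L}_{f'}^{-1},\theta)\in AUT(G,\circ)$. *)

theory Defs
  imports "HOL-Algebra.Bij"
begin

text \<open>
  Loops are carried by the monoid records of HOL-Algebra, without associativity.
\<close>

locale loop =
  fixes L (structure)
  assumes m_closed [intro, simp]:
      "\<lbrakk>x \<in> carrier L; y \<in> carrier L\<rbrakk> \<Longrightarrow> x \<otimes> y \<in> carrier L"
    and left_divisible:
      "\<lbrakk>a \<in> carrier L; b \<in> carrier L\<rbrakk> \<Longrightarrow> \<exists>!x. x \<in> carrier L \<and> a \<otimes> x = b"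
    and right_divisible:
      "\<lbrakk>a \<in> carrier L; b \<in> carrier L\<rbrakk> \<Longrightarrow> \<exists>!y. y \<in> carrier L \<and> y \<otimes> a = b"
    and one_closed [intro, simp]: "\<one> \<in> carrier L"
    and l_one [simp]: "x \<in> carrier L \<Longrightarrow> \<one> \<otimes> x = x"
    and r_one [simp]: "x \<in> carrier L \<Longrightarrow> x \<otimes> \<one> = x"

definition s_subgroup :: "'a set \<Rightarrow> ('a, 'm) monoid_scheme \<Rightarrow> bool" where
  "s_subgroup H L \<longleftrightarrow> H \<subseteq> carrier L \<and> group (L\<lparr>carrier := H\<rparr>) \<and>
     H \<noteq> {\<one>\<^bsub>L\<^esub>} \<and> H \<noteq> carrier L"

definition smarandache_loop :: "('a, 'm) monoid_scheme \<Rightarrow> bool" where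
  "smarandache_loop L \<longleftrightarrow> loop L \<and> (\<exists>H. s_subgroup H L)"

abbreviation SYM :: "('a, 'm) monoid_scheme \<Rightarrow> ('a \<Rightarrow> 'a) monoid" where
  "SYM L \<equiv> BijGroup (carrier L)"

definition left_trans :: "('a, 'm) monoid_scheme \<Rightarrow> 'a \<Rightarrow> 'a \<Rightarrow> 'a" where
  "left_trans L x = (\<lambda>y\<in>carrier L. x \<otimes>\<^bsub>L\<^esub> y)"

definition right_trans :: "('a, 'm) monoid_scheme \<Rightarrow> 'a \<Rightarrow> 'a \<Rightarrow> 'a" where
  "right_trans L x = (\<lambda>y\<in>carrier L. y \<otimes>\<^bsub>L\<^esub> x)"

definition AUT ::
  "('a, 'm) monoid_scheme \<Rightarrow> (('a \<Rightarrow> 'a) \<times> ('a \<Rightarrow> 'a) \<times> ('a \<Rightarrow> 'a)) set" where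
  "AUT L = {(U, V, W). U \<in> carrier (SYM L) \<and> V \<in> carrier (SYM L) \<and> W \<in> carrier (SYM L) \<and>
     (\<forall>x\<in>carrier L. \<forall>y\<in>carrier L. U x \<otimes>\<^bsub>L\<^esub> V y = W (x \<otimes>\<^bsub>L\<^esub> y))}"

definition SSYM :: "('a, 'm) monoid_scheme \<Rightarrow> 'a set \<Rightarrow> ('a \<Rightarrow> 'a) set" where
  "SSYM L H = {\<theta> \<in> carrier (SYM L). \<forall>h\<in>H. \<theta> h \<in> H}"

text \<open>
  With maps written on the right, \<open>\<theta> R\<^sub>g\<inverse>\<close> applies \<open>\<theta>\<close> first. The product of
  \<^const>\<open>BijGroup\<close> applies its right factor first, so the factors appear in reverse order.
\<close>

definition SBS :: "('a, 'm) monoid_scheme \<Rightarrow> 'a set \<Rightarrow> ('a \<Rightarrow> 'a) set" where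
  "SBS L H = {\<theta> \<in> SSYM L H. \<exists>f\<in>H. \<exists>g\<in>H.
     (inv\<^bsub>SYM L\<^esub> (right_trans L g) \<otimes>\<^bsub>SYM L\<^esub> \<theta>,
      inv\<^bsub>SYM L\<^esub> (left_trans L f) \<otimes>\<^bsub>SYM L\<^esub> \<theta>,
      \<theta>) \<in> AUT L}"

text \<open>
  The identity element of the \<open>f,g\<close>-principal isotope is \<open>f \<otimes> g\<close>; see
  \<open>principal_isotope_loop\<close> below.
\<close>

definition principal_isotope ::
  "('a, 'm) monoid_scheme \<Rightarrow> 'a \<Rightarrow> 'a \<Rightarrow> ('a, 'm) monoid_scheme" where
  "principal_isotope L f g = L\<lparr>
     mult := (\<lambda>x y. (inv\<^bsub>SYM L\<^esub> (right_trans L g)) x \<otimes>\<^bsub>L\<^esub> (inv\<^bsub>SYM L\<^esub> (left_trans L f)) y),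
     one := f \<otimes>\<^bsub>L\<^esub> g\<rparr>"

context loop
begin

lemma left_trans_Bij: "a \<in> carrier L \<Longrightarrow> left_trans L a \<in> Bij (carrier L)"
  using left_divisible[of a]
  by (auto simp: Bij_def left_trans_def bij_betw_def inj_on_def image_iff) (metis m_closed)+

lemma right_trans_Bij: "a \<in> carrier L \<Longrightarrow> right_trans L a \<in> Bij (carrier L)"
  using right_divisible[of a]
  by (auto simp: Bij_def right_trans_def bij_betw_def inj_on_def image_iff) (metis m_closed)+

lemma inv_left_trans:
  assumes "a \<in> carrier L" "x \<in> carrier L"
  shows "(inv\<^bsub>SYM L\<^esub> (left_trans L a)) x \<in> carrier L"
    and "a \<otimes> (inv\<^bsub>SYM L\<^esub> (left_trans L a)) x = x"
    and "(inv\<^bsub>SYM L\<^esub> (left_trans L a)) (a \<otimes> x) = x"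
proof -
  let ?S = "carrier L" and ?f = "left_trans L a"
  have b: "bij_betw ?f ?S ?S"
    and inv: "inv\<^bsub>SYM L\<^esub> ?f = (\<lambda>x\<in>?S. inv_into ?S ?f x)"
    using left_trans_Bij[OF assms(1)] inv_BijGroup by (auto simp: Bij_def)
  show 1: "(inv\<^bsub>SYM L\<^esub> ?f) x \<in> ?S"
    using b assms by (simp add: inv bij_betw_def inv_into_into)
  have "?f ((inv\<^bsub>SYM L\<^esub> ?f) x) = x"
    using b assms by (simp add: inv bij_betw_inv_into_right)
  then show "a \<otimes> (inv\<^bsub>SYM L\<^esub> ?f) x = x"
    using 1 by (simp add: left_trans_def)
  have "(inv\<^bsub>SYM L\<^esub> ?f) (?f x) = x"
    using b assms by (simp add: inv bij_betw_inv_into_left bij_betwE)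
  then show "(inv\<^bsub>SYM L\<^esub> ?f) (a \<otimes> x) = x"
    using assms by (simp add: left_trans_def)
qed

lemma inv_right_trans:
  assumes "a \<in> carrier L" "x \<in> carrier L"
  shows "(inv\<^bsub>SYM L\<^esub> (right_trans L a)) x \<in> carrier L"
    and "(inv\<^bsub>SYM L\<^esub> (right_trans L a)) x \<otimes> a = x"
    and "(inv\<^bsub>SYM L\<^esub> (right_trans L a)) (x \<otimes> a) = x"
proof -
  let ?S = "carrier L" and ?f = "right_trans L a"
  have b: "bij_betw ?f ?S ?S"
    and inv: "inv\<^bsub>SYM L\<^esub> ?f = (\<lambda>x\<in>?S. inv_into ?S ?f x)"
    using right_trans_Bij[OF assms(1)] inv_BijGroup by (auto simp: Bij_def)
  show 1: "(inv\<^bsub>SYM L\<^esub> ?f) x \<in> ?S"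
    using b assms by (simp add: inv bij_betw_def inv_into_into)
  have "?f ((inv\<^bsub>SYM L\<^esub> ?f) x) = x"
    using b assms by (simp add: inv bij_betw_inv_into_right)
  then show "(inv\<^bsub>SYM L\<^esub> ?f) x \<otimes> a = x"
    using 1 by (simp add: right_trans_def)
  have "(inv\<^bsub>SYM L\<^esub> ?f) (?f x) = x"
    using b assms by (simp add: inv bij_betw_inv_into_left bij_betwE)
  then show "(inv\<^bsub>SYM L\<^esub> ?f) (x \<otimes> a) = x"
    using assms by (simp add: right_trans_def)
qed

lemma principal_isotope_simps [simp]:
  "carrier (principal_isotope L f g) = carrier L"
  "\<one>\<^bsub>principal_isotope L f g\<^esub> = f \<otimes> g"
  "x \<otimes>\<^bsub>principal_isotope L f g\<^esub> y =
     (inv\<^bsub>SYM L\<^esub> (right_trans L g)) x \<otimes> (inv\<^bsub>SYM L\<^esub> (left_trans L f)) y"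
  by (simp_all add: principal_isotope_def)

lemma principal_isotope_loop:
  assumes f: "f \<in> carrier L" and g: "g \<in> carrier L"
  shows "loop (principal_isotope L f g)"
proof (unfold_locales, unfold principal_isotope_simps)
  let ?r = "inv\<^bsub>SYM L\<^esub> (right_trans L g)" and ?l = "inv\<^bsub>SYM L\<^esub> (left_trans L f)"
  note l = inv_left_trans[OF f] and r = inv_right_trans[OF g]
  show "?r x \<otimes> ?l y \<in> carrier L" if "x \<in> carrier L" "y \<in> carrier L" for x y
    using that l r by simp
  show "\<exists>!x. x \<in> carrier L \<and> ?r a \<otimes> ?l x = b"
    if a: "a \<in> carrier L" and b: "b \<in> carrier L" for a b
  proof -
    obtain z where z: "z \<in> carrier L" "?r a \<otimes> z = b"
      and u: "\<And>z'. z' \<in> carrier L \<Longrightarrow> ?r a \<otimes> z' = b \<Longrightarrow> z' = z"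
      using left_divisible[of "?r a" b] r(1)[OF a] b by blast
    show ?thesis
    proof (rule ex1I[of _ "f \<otimes> z"])
      show "f \<otimes> z \<in> carrier L \<and> ?r a \<otimes> ?l (f \<otimes> z) = b" using z f l by simp
      fix x assume "x \<in> carrier L \<and> ?r a \<otimes> ?l x = b"
      then show "x = f \<otimes> z" using u[of "?l x"] l by auto
    qed
  qed
  show "\<exists>!y. y \<in> carrier L \<and> ?r y \<otimes> ?l a = b"
    if a: "a \<in> carrier L" and b: "b \<in> carrier L" for a b
  proof -
    obtain z where z: "z \<in> carrier L" "z \<otimes> ?l a = b"
      and u: "\<And>z'. z' \<in> carrier L \<Longrightarrow> z' \<otimes> ?l a = b \<Longrightarrow> z' = z"
      using right_divisible[of "?l a" b] l(1)[OF a] b by blast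
    show ?thesis
    proof (rule ex1I[of _ "z \<otimes> g"])
      show "z \<otimes> g \<in> carrier L \<and> ?r (z \<otimes> g) \<otimes> ?l a = b" using z g r by simp
      fix x assume "x \<in> carrier L \<and> ?r x \<otimes> ?l a = b"
      then show "x = z \<otimes> g" using u[of "?r x"] r by auto
    qed
  qed
  show "f \<otimes> g \<in> carrier L" using f g by simp
  show "?r (f \<otimes> g) \<otimes> ?l x = x" if "x \<in> carrier L" for x using that f g l r by simp
  show "?r x \<otimes> ?l (f \<otimes> g) = x" if "x \<in> carrier L" for x using that f g l r by simp
qed

lemma principal_isotope_s_subgroup:
  assumes H: "s_subgroup H L" and f: "f \<in> H" and g: "g \<in> H"
  shows "s_subgroup H (principal_isotope L f g)"
proof -
  interpret K: group "L\<lparr>carrier := H\<rparr>" using H by (simp add: s_subgroup_def)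
  let ?r = "inv\<^bsub>SYM L\<^esub> (right_trans L g)" and ?l = "inv\<^bsub>SYM L\<^esub> (left_trans L f)"
  let ?i = "m_inv (L\<lparr>carrier := H\<rparr>)"
  have sub: "H \<subseteq> carrier L" using H by (simp add: s_subgroup_def)
  have c [simp]: "x \<otimes> y \<in> H" if "x \<in> H" "y \<in> H" for x y using K.m_closed that by simp
  have o [simp]: "\<one> \<in> H" using K.one_closed by simp
  have i [simp]: "?i x \<in> H" if "x \<in> H" for x using K.inv_closed that by simp
  have as: "x \<otimes> y \<otimes> z = x \<otimes> (y \<otimes> z)" if "x \<in> H" "y \<in> H" "z \<in> H" for x y z
    using K.m_assoc that by simp
  have ii [simp]: "?i x \<otimes> x = \<one>" "x \<otimes> ?i x = \<one>" if "x \<in> H" for x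
    using K.l_inv K.r_inv that by simp_all
  have cH [simp]: "x \<in> carrier L" if "x \<in> H" for x using that sub by blast
  have canc: "?i x \<otimes> (x \<otimes> y) = y" "x \<otimes> (?i x \<otimes> y) = y" if "x \<in> H" "y \<in> H" for x y
    using that by (simp_all add: as[symmetric])
  have r: "?r x = x \<otimes> ?i g" if x: "x \<in> H" for x
    using inv_right_trans(3)[of g "x \<otimes> ?i g"] x g by (simp add: as)
  have l: "?l x = ?i f \<otimes> x" if x: "x \<in> H" for x
    using inv_left_trans(3)[of f "?i f \<otimes> x"] x f by (simp add: canc)
  have "group ((principal_isotope L f g)\<lparr>carrier := H\<rparr>)"
  proof (rule groupI, simp_all add: f g r l)
    fix x y z assume "x \<in> H" "y \<in> H" "z \<in> H"
    then show "x \<otimes> ?i g \<otimes> (?i f \<otimes> y) \<otimes> ?i g \<otimes> (?i f \<otimes> z) =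
        x \<otimes> ?i g \<otimes> (?i f \<otimes> (y \<otimes> ?i g \<otimes> (?i f \<otimes> z)))"
      using f g by (simp add: as)
  next
    fix x assume "x \<in> H"
    then show "f \<otimes> g \<otimes> ?i g \<otimes> (?i f \<otimes> x) = x" using f g by (simp add: as canc)
  next
    fix x assume x: "x \<in> H"
    show "\<exists>y\<in>H. y \<otimes> ?i g \<otimes> (?i f \<otimes> x) = f \<otimes> g"
      by (rule bexI[of _ "f \<otimes> g \<otimes> ?i x \<otimes> f \<otimes> g"]) (use x f g in \<open>simp_all add: as canc\<close>)
  qed
  moreover have "H \<noteq> {f \<otimes> g}"
    using H o unfolding s_subgroup_def by (metis singletonD)
  ultimately show ?thesis using H by (simp add: s_subgroup_def)
qed

end

end

theory Submission
  imports Defs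
begin

text \<open>
  A map \<open>\<theta>\<close> lies in \<open>SBS L H\<close> iff it is an isomorphism from \<open>L\<close> onto one of its Smarandache
  principal isotopes. Let \<open>J\<close> be the \<open>f,g\<close>-principal isotope of \<open>L\<close>. If \<open>\<theta>\<close> maps \<open>L\<close> onto the
  \<open>p,q\<close>-principal isotope of \<open>L\<close>, then it maps \<open>J\<close> onto the \<open>c \<otimes> g, f \<otimes> d\<close>-principal isotope
  of \<open>J\<close>, where \<open>c \<otimes> q = \<theta> f\<close> and \<open>p \<otimes> d = \<theta> g\<close>; both parameters lie in \<open>H\<close>.
  Hence \<open>SBS L H \<subseteq> SBS J H\<close>, and equality follows because \<open>L\<close> is in turn the \<open>g,f\<close>-principal
  isotope of \<open>J\<close>.
\<close>

text \<open>Twice-formed isotopes are known to agree with the original loop only on the carrier, so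
  the records cannot simply be identified. Every product in \<open>SBS\<close> has its factors in
  the carrier.\<close>

lemma SBS_cong:
  assumes carrier: "carrier K = carrier L"
    and mult: "\<And>x y. \<lbrakk>x \<in> carrier L; y \<in> carrier L\<rbrakk> \<Longrightarrow> x \<otimes>\<^bsub>K\<^esub> y = x \<otimes>\<^bsub>L\<^esub> y"
    and sub: "H \<subseteq> carrier L"
  shows "SBS K H = SBS L H"
proof -
  have "left_trans K a = left_trans L a" "right_trans K a = right_trans L a" if "a \<in> H" for a
    using that sub mult by (auto simp: left_trans_def right_trans_def carrier fun_eq_iff)
  moreover have "U x \<in> carrier L" if "U \<in> carrier (SYM L)" "x \<in> carrier L" for U x
    using that by (auto simp: BijGroup_def Bij_def dest: bij_betwE)
  then have "AUT K = AUT L"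
    by (auto simp: AUT_def carrier mult)
  moreover have "SSYM K H = SSYM L H"
    by (simp add: SSYM_def carrier)
  ultimately show ?thesis
    by (simp add: SBS_def carrier)
qed

context loop
begin

text \<open>\<open>SYM L\<close> is a group containing the translations, so the first two components
  of the triple are bijections automatically. What remains is that \<theta> is a homomorphism into
  the \<open>f,g\<close>-principal isotope.\<close>

lemma SBS_iff:
  assumes "H \<subseteq> carrier L"
  shows "\<theta> \<in> SBS L H \<longleftrightarrow> \<theta> \<in> SSYM L H \<and> (\<exists>f\<in>H. \<exists>g\<in>H. \<forall>x\<in>carrier L. \<forall>y\<in>carrier L.
    (inv\<^bsub>SYM L\<^esub> (right_trans L g)) (\<theta> x) \<otimes> (inv\<^bsub>SYM L\<^esub> (left_trans L f)) (\<theta> y) = \<theta> (x \<otimes> y))"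
proof -
  interpret S: group "SYM L" by (rule group_BijGroup)
  have app: "(U \<otimes>\<^bsub>SYM L\<^esub> V) x = U (V x)"
    if "U \<in> carrier (SYM L)" "V \<in> carrier (SYM L)" "x \<in> carrier L" for U V x
    using that by (simp add: BijGroup_def compose_def)
  have trans: "left_trans L a \<in> carrier (SYM L)" "right_trans L a \<in> carrier (SYM L)"
    if "a \<in> H" for a
    using that assms left_trans_Bij right_trans_Bij by (auto simp: BijGroup_def)
  show ?thesis
    by (simp add: SBS_def SSYM_def AUT_def app trans cong: conj_cong bex_cong)
qed

text \<open>Since H is closed under the product of the \<open>a,a\<close>-principal isotope, it
  suffices to see both values as such products: that of \<open>a\<close> and \<open>x\<close> is
  \<open>\<one>\<close> times the left quotient of \<open>x\<close> by \<open>a\<close>, and that of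
  \<open>x\<close> and \<open>a\<close> is the right quotient times \<open>\<one>\<close>.\<close>

lemma s_subgroup_inv_trans_closed:
  assumes H: "s_subgroup H L" and a: "a \<in> H" and x: "x \<in> H"
  shows "(inv\<^bsub>SYM L\<^esub> (left_trans L a)) x \<in> H" and "(inv\<^bsub>SYM L\<^esub> (right_trans L a)) x \<in> H"
proof -
  have sub: "a \<in> carrier L" "x \<in> carrier L" using assms by (auto simp: s_subgroup_def)
  interpret K: group "(principal_isotope L a a)\<lparr>carrier := H\<rparr>"
    using principal_isotope_s_subgroup[OF H a a] by (simp add: s_subgroup_def)
  show "(inv\<^bsub>SYM L\<^esub> (left_trans L a)) x \<in> H"
    using K.m_closed[of a x] a x inv_right_trans(3)[of a \<one>] inv_left_trans(1)[of a x] sub by simp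
  show "(inv\<^bsub>SYM L\<^esub> (right_trans L a)) x \<in> H"
    using K.m_closed[of x a] a x inv_left_trans(3)[of a \<one>] inv_right_trans(1)[of a x] sub by simp
qed

text \<open>In the inner isotope, right translation by \<open>f\<close> is the inverse of right
  translation by \<open>g\<close> in \<open>L\<close>, and left translation by \<open>g\<close> is
  the inverse of left translation by \<open>f\<close>. The outer isotope therefore undoes
  both.\<close>

lemma principal_isotope_principal_isotope:
  assumes f: "f \<in> carrier L" and g: "g \<in> carrier L"
    and x: "x \<in> carrier L" and y: "y \<in> carrier L"
  shows "x \<otimes>\<^bsub>principal_isotope (principal_isotope L f g) g f\<^esub> y = x \<otimes> y"
proof -
  let ?J = "principal_isotope L f g"
  interpret J: loop ?J using principal_isotope_loop[OF f g] .
  note l = inv_left_trans[OF f] and r = inv_right_trans[OF g]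
  have "(inv\<^bsub>SYM L\<^esub> (right_trans ?J f)) x = x \<otimes> g"
    using J.inv_right_trans(3)[of f "x \<otimes> g"] l(3)[of \<one>] r(3)[of x] f g x by simp
  moreover have "(inv\<^bsub>SYM L\<^esub> (left_trans ?J g)) y = f \<otimes> y"
    using J.inv_left_trans(3)[of g "f \<otimes> y"] r(3)[of \<one>] l(3)[of y] f g y by simp
  ultimately show ?thesis
    using l(3) r(3) x y by simp
qed

lemma SBS_subset_principal_isotope:
  assumes H: "s_subgroup H L" and f: "f \<in> H" and g: "g \<in> H"
  shows "SBS L H \<subseteq> SBS (principal_isotope L f g) H"
proof
  let ?J = "principal_isotope L f g"
  let ?r = "\<lambda>a. inv\<^bsub>SYM L\<^esub> (right_trans L a)" and ?l = "\<lambda>a. inv\<^bsub>SYM L\<^esub> (left_trans L a)"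
  have sub: "H \<subseteq> carrier L" using H by (simp add: s_subgroup_def)
  then have fg: "f \<in> carrier L" "g \<in> carrier L" using f g by auto
  interpret K: group "L\<lparr>carrier := H\<rparr>" using H by (simp add: s_subgroup_def)
  interpret J: loop ?J using principal_isotope_loop[OF fg] .
  note l = inv_left_trans[OF fg(1)] and r = inv_right_trans[OF fg(2)]
  fix \<theta> assume "\<theta> \<in> SBS L H"
  then obtain p q where \<theta>: "\<theta> \<in> SSYM L H" and p: "p \<in> H" and q: "q \<in> H"
    and hom: "\<And>x y. \<lbrakk>x \<in> carrier L; y \<in> carrier L\<rbrakk> \<Longrightarrow> ?r q (\<theta> x) \<otimes> ?l p (\<theta> y) = \<theta> (x \<otimes> y)"
    unfolding SBS_iff[OF sub] by blast
  have pq: "p \<in> carrier L" "q \<in> carrier L" using p q sub by auto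
  note lp = inv_left_trans[OF pq(1)] and rq = inv_right_trans[OF pq(2)]
  have \<theta>_closed: "\<theta> x \<in> carrier L" if "x \<in> carrier L" for x
    using \<theta> that by (auto simp: SSYM_def BijGroup_def Bij_def dest: bij_betwE)
  \<comment> \<open>These are the constant factors that \<open>hom\<close> produces: \<theta> of
    \<open>x' \<otimes> g\<close> has right factor \<open>d\<close>, and \<theta> of
    \<open>f \<otimes> y'\<close> has left factor \<open>c\<close>.\<close>
  define c d where "c = ?r q (\<theta> f)" and "d = ?l p (\<theta> g)"
  have "c \<in> H" "d \<in> H"
    using s_subgroup_inv_trans_closed[OF H] \<theta> f g p q by (simp_all add: c_def d_def SSYM_def)
  then have cd: "c \<in> carrier L" "d \<in> carrier L" "c \<otimes> g \<in> H" "f \<otimes> d \<in> H"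
    using sub K.m_closed f g by auto
  have "(inv\<^bsub>SYM ?J\<^esub> (right_trans ?J (f \<otimes> d))) (\<theta> x) \<otimes>\<^bsub>?J\<^esub>
      (inv\<^bsub>SYM ?J\<^esub> (left_trans ?J (c \<otimes> g))) (\<theta> y) = \<theta> (x \<otimes>\<^bsub>?J\<^esub> y)"
    if x: "x \<in> carrier L" and y: "y \<in> carrier L" for x y
  proof -
    define x' y' where "x' = ?r g x" and "y' = ?l f y"
    have x': "x' \<in> carrier L" "x' \<otimes> g = x" and y': "y' \<in> carrier L" "f \<otimes> y' = y"
      using l r x y by (simp_all add: x'_def y'_def)
    define u v where "u = ?r q (\<theta> x')" and "v = ?l p (\<theta> y')"
    have uv: "u \<in> carrier L" "v \<in> carrier L"
      using lp(1) rq(1) \<theta>_closed x' y' by (simp_all add: u_def v_def)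
    have "u \<otimes> d = \<theta> x" "c \<otimes> v = \<theta> y"
      using hom[OF x'(1) fg(2)] hom[OF fg(1) y'(1)] x' y' by (simp_all add: u_def v_def c_def d_def)
    \<comment> \<open>In \<open>?J\<close> the product of \<open>a \<otimes> g\<close> and
      \<open>f \<otimes> b\<close> is \<open>a \<otimes> b\<close>. Both factorizations thus become
      products in \<open>?J\<close>, from which the quotients by the new parameters can be read
      off.\<close>
    then have "(u \<otimes> g) \<otimes>\<^bsub>?J\<^esub> (f \<otimes> d) = \<theta> x" "(c \<otimes> g) \<otimes>\<^bsub>?J\<^esub> (f \<otimes> v) = \<theta> y"
      using l(3) r(3) uv cd by simp_all
    then have "(inv\<^bsub>SYM ?J\<^esub> (right_trans ?J (f \<otimes> d))) (\<theta> x) = u \<otimes> g"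
      "(inv\<^bsub>SYM ?J\<^esub> (left_trans ?J (c \<otimes> g))) (\<theta> y) = f \<otimes> v"
      using J.inv_right_trans(3)[of "f \<otimes> d" "u \<otimes> g"] J.inv_left_trans(3)[of "c \<otimes> g" "f \<otimes> v"]
        uv cd fg by simp_all
    \<comment> \<open>The product of the two quotients in \<open>?J\<close> is
      \<open>u \<otimes> v\<close>, which \<open>hom\<close> identifies with \<theta> of
      \<open>x' \<otimes> y'\<close>, the product of \<open>x\<close> and \<open>y\<close> in
      \<open>?J\<close>.\<close>
    then show ?thesis
      using l(3) r(3) uv hom[OF x'(1) y'(1)] by (simp add: u_def v_def x'_def y'_def)
  qed
  moreover have "\<theta> \<in> SSYM ?J H" using \<theta> by (simp add: SSYM_def)
  ultimately show "\<theta> \<in> SBS ?J H"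
    using J.SBS_iff[of H \<theta>] sub cd(3,4) unfolding principal_isotope_simps(1) by blast
qed

end

theorem theorem3p5:
  fixes G :: "('a, 'm) monoid_scheme" and H :: "'a set" and f g :: 'a
  assumes "smarandache_loop G"
    and "s_subgroup H G"
    and "f \<in> H" and "g \<in> H"
  shows "SBS G H = SBS (principal_isotope G f g) H"
proof
  interpret loop G using assms(1) by (simp add: smarandache_loop_def)
  let ?J = "principal_isotope G f g"
  have sub: "H \<subseteq> carrier G" using assms(2) by (simp add: s_subgroup_def)
  then have fg: "f \<in> carrier G" "g \<in> carrier G" using assms(3,4) by auto
  interpret J: loop ?J using principal_isotope_loop[OF fg] .
  show "SBS G H \<subseteq> SBS ?J H"
    using SBS_subset_principal_isotope[OF assms(2-4)] .
  have "SBS ?J H \<subseteq> SBS (principal_isotope ?J g f) H"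
    using J.SBS_subset_principal_isotope principal_isotope_s_subgroup assms by blast
  also have "\<dots> = SBS G H"
    using sub principal_isotope_principal_isotope[OF fg]
    by (intro SBS_cong) (simp_all only: J.principal_isotope_simps(1) principal_isotope_simps(1))
  finally show "SBS ?J H \<subseteq> SBS G H" .
qed

end
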